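(* Let $k\in\mathbb{Z}_{\ge1}$, let $H$ be a $(k+1)$-uniform hypergraph, let $q,w\in\mathbb{C}$ with $w^k\neq1$, and let $(w^k-1)^{1/k}$ denote a fixed choice of $k$-th root of $w^k-1$ (with $(w^k-1)^{n/k}$ meaning its $n$-th power for integers $n$). Then $$Z_{\mathrm{P}}(H;q,w)=q^{\kappa(H)}\,(w^k-1)^{\frac{v(H)-\kappa(H)}{k}}\;T_{\mathrm{HG}}\!\left(H;\frac{q}{(w^k-1)^{1/k}}+1,\;(w^k-1)^{1/k}+1\right).$$
   Context: A hypergraph is a pair $H=(V,E)$ where $V$ is a finite set and $E$ is a finite multiset (parallel hyperedges are allowed and treated as distinct elements of $E$) of multisets of elements of $V$, called hyperedges. For $e\in E$, $d(e)$ is the size of $e$ counted with multiplicity; it is always assumed that $d(e)>1$. $H$ is $(k+1)$-uniform if $d(e)=k+1$ for all $e\in E$. Write $v(H)=|V|$. $\kappa(H)$ is the number of connected components of the bipartite incidence graph with vertex classes $V$ and $E$, in which $u\in V$ and $e\in E$ are joined by as many edges as the multiplicity of $u$ in $e$. For $A\subseteq E$ let $\kappa(A)=\kappa((V,A))$, $d(A)=\sum_{e\in A}d(e)$, and $|A|$ is the number of hyperedges in $A$. Hypergraph Tutte polynomial: $T_{\mathrm{HG}}(H;x,y)=\sum_{A\subseteq E}(x-1)^{\kappa(A)-\kappa(H)}(y-1)^{d(A)-|A|-v(H)+\kappa(A)}$. Degree-dependent hypergraph Potts partition function: $Z_{\mathrm{P}}(H;q,w)=\sum_{A\subseteq E}q^{\kappa(A)}\prod_{e\in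 A}(w^{d(e)-1}-1)$. *)

theory Defs
  imports Complex_Main "HOL-Library.Multiset" "Graph_Theory.Digraph_Component"
begin

text \<open>
  The multiset of hyperedges is represented as a family indexed by a set of names: every
  name in \<open>hedges H\<close> is one hyperedge, and \<open>hends H e\<close> is its multiset of vertices. Parallel
  hyperedges are distinct names with the same ends, so subsets \<open>A \<subseteq> E\<close> are plain subsets of
  \<open>hedges H\<close>.
\<close>

record ('v, 'e) hypergraph =
  hverts :: "'v set"
  hedges :: "'e set"
  hends  :: "'e \<Rightarrow> 'v multiset"

definition hsize :: "('v, 'e) hypergraph \<Rightarrow> 'e \<Rightarrow> nat" where
  "hsize H e = size (hends H e)"

locale hypergraph =
  fixes H :: "('v, 'e) hypergraph"
  assumes finite_hverts: "finite (hverts H)"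
    and finite_hedges: "finite (hedges H)"
    and hends_in_hverts: "\<And>e. e \<in> hedges H \<Longrightarrow> set_mset (hends H e) \<subseteq> hverts H"
    and hsize_gt_1: "\<And>e. e \<in> hedges H \<Longrightarrow> hsize H e > 1"

definition uniform :: "nat \<Rightarrow> ('v, 'e) hypergraph \<Rightarrow> bool" where
  "uniform r H \<longleftrightarrow> (\<forall>e\<in>hedges H. hsize H e = r)"

text \<open>
  Undirected graphs are symmetric digraphs here. The \<open>i\<close>-th of the \<open>count (hends H e) u\<close>
  parallel incidence edges between \<open>u\<close> and \<open>e\<close> becomes the two opposite arcs
  \<open>(u, e, i, True)\<close> (from \<open>u\<close> to \<open>e\<close>) and \<open>(u, e, i, False)\<close> (from \<open>e\<close> to \<open>u\<close>).
\<close>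

definition incidence_graph ::
    "('v, 'e) hypergraph \<Rightarrow> ('v + 'e, 'v \<times> 'e \<times> nat \<times> bool) pre_digraph" where
  "incidence_graph H =
    \<lparr> verts = hverts H <+> hedges H,
      arcs = {(u, e, i, b). u \<in> hverts H \<and> e \<in> hedges H \<and> i < count (hends H e) u},
      tail = (\<lambda>(u, e, i, b). if b then Inl u else Inr e),
      head = (\<lambda>(u, e, i, b). if b then Inr e else Inl u) \<rparr>"

text \<open>
  In a symmetric digraph the strongly connected components are the connected components.
\<close>

lemma (in hypergraph) pseudo_graph_incidence_graph: "pseudo_graph (incidence_graph H)"
proof -
  interpret wf_digraph "incidence_graph H"
    by unfold_locales (auto simp: incidence_graph_def)
  have "finite (arcs (incidence_graph H))"
  proof (rule finite_subset)
    show "arcs (incidence_graph H) \<subseteq>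
        (\<Union>u\<in>hverts H. \<Union>e\<in>hedges H. {u} \<times> {e} \<times> {..<count (hends H e) u} \<times> UNIV)"
      by (auto simp: incidence_graph_def)
    show "finite (\<Union>u\<in>hverts H. \<Union>e\<in>hedges H.
        {u} \<times> {e} \<times> {..<count (hends H e) u} \<times> (UNIV :: bool set))"
      using finite_hverts finite_hedges by auto
  qed
  moreover have "finite (verts (incidence_graph H))"
    using finite_hverts finite_hedges by (simp add: incidence_graph_def)
  moreover have "symmetric (incidence_graph H)"
    unfolding symmetric_conv
  proof
    fix a assume a: "a \<in> arcs (incidence_graph H)"
    obtain u e i b where "a = (u, e, i, b)" by (cases a)
    with a show "\<exists>a'\<in>arcs (incidence_graph H).
        tail (incidence_graph H) a = head (incidence_graph H) a' \<and>
        head (incidence_graph H) a = tail (incidence_graph H) a'"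
      by (intro bexI[of _ "(u, e, i, \<not> b)"]) (auto simp: incidence_graph_def)
  qed
  ultimately show ?thesis by unfold_locales
qed

definition kappa :: "('v, 'e) hypergraph \<Rightarrow> nat" where
  "kappa H = card (pre_digraph.sccs (incidence_graph H))"

definition kappa_sub :: "('v, 'e) hypergraph \<Rightarrow> 'e set \<Rightarrow> nat" where
  "kappa_sub H A = kappa (H\<lparr>hedges := A\<rparr>)"

text \<open>
  Both exponents are nonnegative for every \<open>A \<subseteq> E\<close> (the second is the cycle rank of the
  incidence graph of \<open>(V, A)\<close>); integer powers avoid truncated subtraction, and
  \<open>0 powi 0 = 1\<close> as for polynomials.
\<close>

definition T_HG :: "('v, 'e) hypergraph \<Rightarrow> 'a :: field \<Rightarrow> 'a \<Rightarrow> 'a" where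
  "T_HG H x y = (\<Sum>A\<in>Pow (hedges H).
     (x - 1) powi (int (kappa_sub H A) - int (kappa H)) *
     (y - 1) powi (int (\<Sum>e\<in>A. hsize H e) - int (card A) - int (card (hverts H))
                    + int (kappa_sub H A)))"

definition Z_P :: "('v, 'e) hypergraph \<Rightarrow> 'a :: comm_ring_1 \<Rightarrow> 'a \<Rightarrow> 'a" where
  "Z_P H q w = (\<Sum>A\<in>Pow (hedges H).
     q ^ kappa_sub H A * (\<Prod>e\<in>A. w ^ (hsize H e - 1) - 1))"

end

theory Submission
  imports Defs
begin

text \<open>
  For a \<open>(k + 1)\<close>-uniform hypergraph \<open>d(A) - |A| = k |A|\<close>, and with \<open>r\<^sup>k = w\<^sup>k - 1\<close> the
  identity holds term by term in the sums over \<open>A\<close>: the powers of \<open>r\<close> on the right add up to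
  \<open>k |A|\<close>. The case \<open>q = 0\<close> requires in addition that \<open>\<kappa>(A) \<ge> \<kappa>(H)\<close>, because otherwise
  \<open>q\<^bsup>\<kappa>(H)\<^esup> q\<^bsup>\<kappa>(A) - \<kappa>(H)\<^esup>\<close> need not be \<open>q\<^bsup>\<kappa>(A)\<^esup>\<close>. This holds since every component of the
  incidence graph of \<open>H\<close> meets \<open>V\<close>, so that the components of \<open>(V, A)\<close> map onto those of \<open>H\<close>.
\<close>

lemma (in hypergraph) hypergraph_restrict_hedges:
  "A \<subseteq> hedges H \<Longrightarrow> hypergraph (H\<lparr>hedges := A\<rparr>)"
  using finite_hverts finite_hedges hends_in_hverts hsize_gt_1
  by unfold_locales (auto simp: hsize_def dest: finite_subset)

text \<open>A component is determined by its vertex set, so components can be handled as classes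
  \<open>scc_of x\<close> instead of subgraphs.\<close>

lemma (in hypergraph) kappa_conv_sccs_verts:
  "kappa H = card (pre_digraph.sccs_verts (incidence_graph H))"
proof -
  interpret pseudo_graph "incidence_graph H" by (rule pseudo_graph_incidence_graph)
  show ?thesis by (simp add: kappa_def card_sccs_verts)
qed

lemma (in hypergraph) subgraph_incidence_graph:
  assumes "A \<subseteq> hedges H"
  shows "subgraph (incidence_graph (H\<lparr>hedges := A\<rparr>)) (incidence_graph H)"
proof -
  interpret G: pseudo_graph "incidence_graph H" by (rule pseudo_graph_incidence_graph)
  interpret HA: hypergraph "H\<lparr>hedges := A\<rparr>" by (rule hypergraph_restrict_hedges[OF assms])
  interpret GA: pseudo_graph "incidence_graph (H\<lparr>hedges := A\<rparr>)"
    by (rule HA.pseudo_graph_incidence_graph)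
  show ?thesis
    using assms GA.wf_digraph_axioms G.wf_digraph_axioms
    by (auto simp: subgraph_def compatible_def incidence_graph_def)
qed

text \<open>A hyperedge has at least one end, so its node is adjacent to a vertex node. Hence
  components have representatives in \<open>hverts H\<close>, a set that does not change when
  hyperedges are removed.\<close>

lemma (in hypergraph) sccs_verts_incidence_graph:
  "pre_digraph.sccs_verts (incidence_graph H) =
    pre_digraph.scc_of (incidence_graph H) ` Inl ` hverts H"
proof -
  let ?G = "incidence_graph H"
  interpret pseudo_graph ?G by (rule pseudo_graph_incidence_graph)
  have "scc_of (Inr e) \<in> scc_of ` Inl ` hverts H" if e: "e \<in> hedges H" for e
  proof -
    have "hends H e \<noteq> {#}"
      using hsize_gt_1[OF e] by (auto simp: hsize_def)
    then obtain u where "u \<in># hends H e" by (meson multiset_nonemptyE)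
    moreover from this have u: "u \<in> hverts H"
      using hends_in_hverts[OF e] by auto
    ultimately have "(u, e, 0, True) \<in> arcs ?G"
      using e by (auto simp: incidence_graph_def)
    then have "Inl u \<rightarrow>\<^bsub>?G\<^esub> Inr e"
      by (intro dominatesI[where a = "(u, e, 0, True)"]) (auto simp: incidence_graph_def arc_to_ends_def)
    then have "Inr e \<in> scc_of (Inl u)"
      by (intro scc_ofI_reachable') auto
    then show ?thesis using u by (auto dest: scc_of_eq)
  qed
  moreover have "verts ?G = Inl ` hverts H \<union> Inr ` hedges H"
    by (auto simp: incidence_graph_def)
  ultimately show ?thesis
    unfolding sccs_verts_conv_scc_of by blast
qed

lemma (in hypergraph) kappa_le_kappa_sub:
  assumes "A \<subseteq> hedges H"
  shows "kappa H \<le> kappa_sub H A"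
proof -
  let ?G = "incidence_graph H" and ?GA = "incidence_graph (H\<lparr>hedges := A\<rparr>)"
  interpret G: pseudo_graph ?G by (rule pseudo_graph_incidence_graph)
  interpret HA: hypergraph "H\<lparr>hedges := A\<rparr>" by (rule hypergraph_restrict_hedges[OF assms])
  interpret GA: pseudo_graph ?GA by (rule HA.pseudo_graph_incidence_graph)
  have scc_mono: "GA.scc_of x \<subseteq> G.scc_of x" for x
    using pre_digraph.reachable_mono[OF _ subgraph_incidence_graph[OF assms]]
    by (auto simp: GA.scc_of_def G.scc_of_def)
  \<comment> \<open>By \<open>scc_mono\<close> all nodes of a component of \<open>?GA\<close> lie in
    one component of \<open>?G\<close>, so the node picked by \<open>SOME\<close> is
    immaterial.\<close>
  have "G.sccs_verts \<subseteq> (\<lambda>S. G.scc_of (SOME x. x \<in> S)) ` GA.sccs_verts"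
  proof
    fix T assume "T \<in> G.sccs_verts"
    then obtain u where u: "u \<in> hverts H" and T: "T = G.scc_of (Inl u)"
      by (auto simp: sccs_verts_incidence_graph)
    let ?S = "GA.scc_of (Inl u)"
    have S: "?S \<in> GA.sccs_verts"
      using u by (intro GA.scc_of_in_sccs_verts) (auto simp: incidence_graph_def)
    then have "(SOME x. x \<in> ?S) \<in> ?S"
      by (auto simp: GA.in_sccs_verts_conv_reachable some_in_eq)
    then have "G.scc_of (SOME x. x \<in> ?S) = T"
      unfolding T using scc_mono by (intro G.scc_of_eq) auto
    then show "T \<in> (\<lambda>S. G.scc_of (SOME x. x \<in> S)) ` GA.sccs_verts"
      using S by blast
  qed
  then have "card G.sccs_verts \<le> card GA.sccs_verts"
    by (rule surj_card_le[OF GA.finite_sccs_verts])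
  then show ?thesis
    by (simp add: kappa_sub_def kappa_conv_sccs_verts HA.kappa_conv_sccs_verts)
qed

theorem corollary5p10:
  fixes k :: nat and H :: "('v, 'e) hypergraph" and q w r :: complex
  assumes "k \<ge> 1"
    and "hypergraph H"
    and "uniform (k + 1) H"
    and "w ^ k \<noteq> 1"
    and root: "r ^ k = w ^ k - 1"
  shows "Z_P H q w =
    q ^ kappa H * r powi (int (card (hverts H)) - int (kappa H)) * T_HG H (q / r + 1) (r + 1)"
proof -
  interpret hypergraph H by fact
  have r: "r \<noteq> 0"
    using assms(1,4) root by (auto simp: power_0_left)
  have powi_add3: "r powi (a + b + c) = r powi a * r powi b * r powi c" for a b c
    using r by (simp add: power_int_add)
  let ?v = "int (card (hverts H))" and ?\<kappa> = "int (kappa H)"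
  have "q ^ kappa_sub H A * (\<Prod>e\<in>A. w ^ (hsize H e - 1) - 1) =
      q ^ kappa H * r powi (?v - ?\<kappa>) *
      ((q / r) powi (int (kappa_sub H A) - ?\<kappa>) *
       r powi (int (\<Sum>e\<in>A. hsize H e) - int (card A) - ?v + int (kappa_sub H A)))"
    if A: "A \<subseteq> hedges H" for A
  proof -
    have size: "hsize H e = k + 1" if "e \<in> A" for e
      using that A assms(3) by (auto simp: uniform_def)
    \<comment> \<open>A natural number \<open>m\<close> lets \<open>q ^ kappa H\<close> be split off
      without dividing by \<open>q\<close>, which may be 0.\<close>
    obtain m where m: "kappa_sub H A = kappa H + m"
      using kappa_le_kappa_sub[OF A] le_Suc_ex by blast
    have "(\<Prod>e\<in>A. w ^ (hsize H e - 1) - 1) = r ^ (k * card A)"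
      using size by (simp add: root power_mult)
    also have "\<dots> = r powi (int k * int (card A))"
      by (simp flip: of_nat_mult)
    \<comment> \<open>The three summands come from the prefactor, from the denominator of
      \<open>(q / r) ^ m\<close>, and from the second factor of the Tutte term.\<close>
    also have "\<dots> = r powi ((?v - ?\<kappa>) + (- int m) + (int k * int (card A) - ?v + (?\<kappa> + int m)))"
      by simp
    also have "\<dots> = r powi (?v - ?\<kappa>) * r powi (- int m) *
        r powi (int k * int (card A) - ?v + (?\<kappa> + int m))"
      by (rule powi_add3)
    finally have "(\<Prod>e\<in>A. w ^ (hsize H e - 1) - 1) = \<dots>" .
    moreover have "int (\<Sum>e\<in>A. hsize H e) - int (card A) = int k * int (card A)"
      using size by (simp add: algebra_simps)
    ultimately show ?thesis
      by (simp add: m power_add power_divide power_int_minus field_simps)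
  qed
  then show ?thesis
    unfolding Z_P_def T_HG_def sum_distrib_left by (intro sum.cong) auto
qed

end
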